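(* Let $G$ be an ordered abelian group and let $S_1,S_2$ be final segments of $G$. Consider the equation $$S_1+T=S_2 \qquad (\mathrm{E})$$ for final segments $T$ of $G$, and the condition $( * )$ $\mathcal{G}(S_1)\subseteq\mathcal{G}(S_2)$, and $S_2/\mathcal{G}(S_2)$ is nonprincipal if $S_1/\mathcal{G}(S_2)$ is nonprincipal. If $( * )$ holds, then $T=S_2-_{\rm fs}S_1$ is the largest solution of (E) (with respect to inclusion), and it is equal to: - $S_2-\alpha$ if $S_1/\mathcal{G}(S_2)=(\alpha/\mathcal{G}(S_2))^-$ with $\alpha\in G$; - $(S_2-S_1^c)^{\diamondsuit}$ if $S_1/\mathcal{G}(S_2)$ is nonprincipal. If $( * )$ does not hold, or equivalently, one of the cases i) $\mathcal{G}(S_2)\subsetneq\mathcal{G}(S_1)$, or ii) $\mathcal{G}(S_1)=\mathcal{G}(S_2)$ and $S_1/\mathcal{G}(S_2)$ is nonprincipal, but $S_2/\mathcal{G}(S_2)$ is principal holds, then (E) has no solution.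
   Context: "Ordered" means totally ordered. A final segment of an ordered abelian group $G$ is a subset $S\subseteq G$ that is upward closed, nonempty and $\ne G$. It is principal if it has a smallest element, and nonprincipal otherwise. For $\alpha\in G$, $\alpha^-:=\{\gamma\in G\mid\gamma\ge\alpha\}$. For $M,N\subseteq G$: $M+N=\{m+n\mid m\in M,n\in N\}$, $M-N=\{m-n\mid m\in M,n\in N\}$, $M-\alpha=M-\{\alpha\}$, and $M^c=G\setminus M$. For final segments, $S_2-_{\rm fs}S_1:=\{\alpha\in G\mid\alpha+S_1\subseteq S_2\}$. The invariance group of $M\subseteq G$ is $\mathcal{G}(M):=\{\gamma\in G\mid M+\gamma=M\}$; for a final segment $S$, $\mathcal{G}(S)$ is a proper convex subgroup of $G$. For a convex subgroup $H$ of $G$, $G/H$ carries the canonical induced ordering ($\alpha\le\beta\Rightarrow\alpha+H\le\beta+H$), $\varphi_H:G\to G/H$ is the canonical epimorphism, $\gamma/H:=\varphi_H(\gamma)$ and $M/H:=\varphi_H(M)$. If $S$ is a final segment of $G$ and $H$ is proper, then $S/H$ is a final segment of $G/H$. For a final segment $S$ of an ordered abelian group, $\widehat S:=S\cup\{\gamma\}$ if $S$ has an infimum $\gamma$ in the group, and $\widehat S:=S$ otherwise. For a final segment $T$ of $G$, $T^{\diamondsuit}$ denotes the preimage of $\widehat{T/\mathcal{G}(T)}$ (formed in $G/\mathcal{G}(T)$) under $\varphi_{\mathcal{G}(T)}$. *)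

theory Defs
  imports "HOL-Library.Set_Algebras" "HOL-Algebra.Order"
begin

text \<open>
  The ordered abelian group \<open>G\<close> is a type of class \<open>linordered_ab_group_add\<close>.
  Its quotients \<open>G/H\<close> cannot be types (\<open>H\<close> varies inside the statement), so notions that are
  used both in \<open>G\<close> and in \<open>G/H\<close> take the ordered set as an explicit \<open>gorder\<close> argument.
  Note that \<open>M + N\<close> on sets is elementwise, whereas \<open>M - N\<close> is the set difference;
  the elementwise difference is written \<open>M \<ominus> N\<close>.
\<close>

definition whole :: "'a::linordered_ab_group_add gorder" where
  "whole = \<lparr>carrier = UNIV, eq = (=), le = (\<le>)\<rparr>"

definition quotient_map :: "'a::linordered_ab_group_add set \<Rightarrow> 'a \<Rightarrow> 'a set" where
  "quotient_map H \<gamma> = \<gamma> +o H"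

text \<open>\<open>G/H\<close> for a convex subgroup \<open>H\<close>; the elements are the cosets of \<open>H\<close>.\<close>

definition quotient_order :: "'a::linordered_ab_group_add set \<Rightarrow> 'a set gorder" where
  "quotient_order H = \<lparr>carrier = range (quotient_map H), eq = (=),
     le = (\<lambda>X Y. \<exists>\<alpha>\<in>X. \<exists>\<beta>\<in>Y. \<alpha> \<le> \<beta>)\<rparr>"

definition final_segment :: "'b gorder \<Rightarrow> 'b set \<Rightarrow> bool" where
  "final_segment L S \<longleftrightarrow> S \<subseteq> carrier L \<and> S \<noteq> {} \<and> S \<noteq> carrier L \<and>
     (\<forall>x\<in>S. \<forall>y\<in>carrier L. le L x y \<longrightarrow> y \<in> S)"

definition principal_in :: "'b gorder \<Rightarrow> 'b set \<Rightarrow> bool" where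
  "principal_in L S \<longleftrightarrow> (\<exists>m. least L m S)"

text \<open>\<open>\<alpha>\<^sup>-\<close>\<close>

definition segment_from :: "'b gorder \<Rightarrow> 'b \<Rightarrow> 'b set" where
  "segment_from L \<alpha> = {\<gamma> \<in> carrier L. le L \<alpha> \<gamma>}"

text \<open>
  The closure of \<open>S\<close> under its infimum: by antisymmetry there is at most one greatest lower
  bound, so at most one element is added.
\<close>

definition add_infimum :: "'b gorder \<Rightarrow> 'b set \<Rightarrow> 'b set" where
  "add_infimum L S = S \<union> {\<gamma>. greatest L \<gamma> (Lower L S)}"

definition elementwise_diff ::
    "'a::linordered_ab_group_add set \<Rightarrow> 'a set \<Rightarrow> 'a set"  (infixl \<open>\<ominus>\<close> 65) where
  "M \<ominus> N = {m - n | m n. m \<in> M \<and> n \<in> N}"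

definition invariance_group :: "'a::linordered_ab_group_add set \<Rightarrow> 'a set" where
  "invariance_group M = {\<gamma>. M + {\<gamma>} = M}"

text \<open>\<open>S\<^sub>2 -\<^sub>f\<^sub>s S\<^sub>1\<close>\<close>

definition fs_diff :: "'a::linordered_ab_group_add set \<Rightarrow> 'a set \<Rightarrow> 'a set" where
  "fs_diff S2 S1 = {\<alpha>. \<alpha> +o S1 \<subseteq> S2}"

definition diamond :: "'a::linordered_ab_group_add set \<Rightarrow> 'a set" where
  "diamond T = (let H = invariance_group T in
     quotient_map H -` add_infimum (quotient_order H) (quotient_map H ` T))"

definition is_solution ::
    "'a::linordered_ab_group_add set \<Rightarrow> 'a set \<Rightarrow> 'a set \<Rightarrow> bool" where
  "is_solution S1 S2 T \<longleftrightarrow> final_segment whole T \<and> S1 + T = S2"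

text \<open>Condition \<open>(*)\<close> for the solvability of \<open>S1 + T = S2\<close>.\<close>

definition solvability_condition ::
    "'a::linordered_ab_group_add set \<Rightarrow> 'a set \<Rightarrow> bool" where
  "solvability_condition S1 S2 \<longleftrightarrow>
     (let H = invariance_group S2 in
      invariance_group S1 \<subseteq> H \<and>
      (\<not> principal_in (quotient_order H) (quotient_map H ` S1) \<longrightarrow>
       \<not> principal_in (quotient_order H) (quotient_map H ` S2)))"

end

theory Submission
  imports Defs
begin

text \<open>
  Everything is read off in \<open>G\<close> itself: \<open>\<alpha>/H \<le> \<beta>/H\<close> iff \<open>\<alpha> \<le> \<beta>\<close> or \<open>\<alpha> - \<beta> \<in> H\<close>. Let \<open>H = \<G>(S\<^sub>2)\<close>.
  If \<open>S\<^sub>1/H\<close> has least element \<open>\<alpha>/H\<close>, then \<open>\<beta> + S\<^sub>1 \<subseteq> S\<^sub>2\<close> iff \<open>\<beta> + \<alpha> \<in> S\<^sub>2\<close>, which settles this case.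
  If \<open>S\<^sub>1/H\<close> and \<open>S\<^sub>2/H\<close> are nonprincipal, then \<open>\<G>(S\<^sub>1) = H\<close>, and any \<open>s \<in> S\<^sub>2\<close> can be lowered in
  \<open>S\<^sub>2\<close> by some \<open>\<delta> > 0\<close> outside \<open>\<G>(S\<^sub>1)\<close>; a step of this size crosses the boundary of \<open>S\<^sub>1\<close>.
  Hence \<open>T = S\<^sub>2 - S\<^sub>1\<^sup>c\<close> already solves the equation, whence \<open>\<G>(T) = H\<close>, and the largest solution
  exceeds \<open>T\<close> exactly by the \<open>\<alpha>\<close> with \<open>\<alpha> + S\<^sub>1 = S\<^sub>2\<close>, which represent the infimum of \<open>T/H\<close>.
\<close>

section \<open>Convex subgroups, and the quotient order in terms of representatives\<close>

locale convex_subgroup =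
  fixes H :: "'a::linordered_ab_group_add set"
  assumes zero_mem: "0 \<in> H"
    and diff_mem: "\<lbrakk>a \<in> H; b \<in> H\<rbrakk> \<Longrightarrow> a - b \<in> H"
    and convex: "\<lbrakk>a \<in> H; 0 \<le> b; b \<le> a\<rbrakk> \<Longrightarrow> b \<in> H"
begin

lemma uminus_mem: "a \<in> H \<Longrightarrow> - a \<in> H"
  using diff_mem[of 0 a] zero_mem by simp

lemma add_mem: "\<lbrakk>a \<in> H; b \<in> H\<rbrakk> \<Longrightarrow> a + b \<in> H"
  using diff_mem[of a "- b"] uminus_mem by simp

lemma diff_mem_commute: "a - b \<in> H \<Longrightarrow> b - a \<in> H"
  using uminus_mem[of "a - b"] by simp

lemma mem_quotient_map: "y \<in> quotient_map H x \<longleftrightarrow> y - x \<in> H"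
proof
  assume "y \<in> quotient_map H x"
  then show "y - x \<in> H"
    by (auto simp: quotient_map_def elt_set_plus_def)
next
  assume "y - x \<in> H"
  moreover have "y = x + (y - x)"
    by simp
  ultimately show "y \<in> quotient_map H x"
    unfolding quotient_map_def elt_set_plus_def by blast
qed

lemma quotient_map_eq_iff: "quotient_map H x = quotient_map H y \<longleftrightarrow> x - y \<in> H"
proof
  assume "quotient_map H x = quotient_map H y"
  then show "x - y \<in> H"
    using mem_quotient_map[of x x] mem_quotient_map[of x y] zero_mem by simp
next
  assume xy: "x - y \<in> H"
  have "z - x \<in> H \<longleftrightarrow> z - y \<in> H" for z
    using add_mem[OF _ xy, of "z - x"] diff_mem[OF _ xy, of "z - y"] by auto
  then show "quotient_map H x = quotient_map H y"
    by (auto simp: mem_quotient_map)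
qed

text \<open>If representatives satisfy \<open>a \<le> b\<close> although \<open>y < x\<close>, then
  \<open>x - y\<close> lies between 0 and the element \<open>(b - y) - (a - x)\<close> of
  \<open>H\<close>, so convexity applies.\<close>

lemma le_quotient_iff:
  "le (quotient_order H) (quotient_map H x) (quotient_map H y) \<longleftrightarrow> x \<le> y \<or> x - y \<in> H"
proof
  assume "le (quotient_order H) (quotient_map H x) (quotient_map H y)"
  then obtain a b where ab: "a - x \<in> H" "b - y \<in> H" "a \<le> b"
    by (auto simp: quotient_order_def mem_quotient_map)
  show "x \<le> y \<or> x - y \<in> H"
  proof (cases "x \<le> y")
    case False
    have "(b - y) - (a - x) \<in> H"
      using ab diff_mem by blast
    moreover have "x - y \<le> (b - y) - (a - x)"
      using ab(3) by (simp add: algebra_simps)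
    ultimately show ?thesis
      using convex[of _ "x - y"] False by simp
  qed simp
next
  assume "x \<le> y \<or> x - y \<in> H"
  then have "\<exists>a. a - x \<in> H \<and> a \<le> y"
  proof
    assume "x \<le> y"
    then show ?thesis
      using zero_mem by (intro exI[of _ x]) simp
  next
    assume "x - y \<in> H"
    then show ?thesis
      using diff_mem_commute by (intro exI[of _ y]) simp
  qed
  then show "le (quotient_order H) (quotient_map H x) (quotient_map H y)"
    using zero_mem mem_quotient_map[of y y] mem_quotient_map[of _ x]
    by (auto simp: quotient_order_def intro!: bexI)
qed

lemma carrier_quotient_order: "carrier (quotient_order H) = range (quotient_map H)"
  by (simp add: quotient_order_def)

lemma principal_quotient_iff:
  "principal_in (quotient_order H) (quotient_map H ` S) \<longleftrightarrow>
     (\<exists>a\<in>S. \<forall>s\<in>S. a \<le> s \<or> a - s \<in> H)"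
  by (auto simp: principal_in_def least_def carrier_quotient_order le_quotient_iff)

lemma infimum_quotient_iff:
  "greatest (quotient_order H) (quotient_map H g) (Lower (quotient_order H) (quotient_map H ` T)) \<longleftrightarrow>
     (\<forall>t\<in>T. g \<le> t \<or> g - t \<in> H) \<and>
     (\<forall>b. (\<forall>t\<in>T. b \<le> t \<or> b - t \<in> H) \<longrightarrow> b \<le> g \<or> b - g \<in> H)"
proof -
  have lower: "quotient_map H b \<in> Lower (quotient_order H) (quotient_map H ` T) \<longleftrightarrow>
      (\<forall>t\<in>T. b \<le> t \<or> b - t \<in> H)" for b
    by (simp add: Lower_def carrier_quotient_order flip: le_quotient_iff) blast
  \<comment> \<open>Every lower bound is a coset, so the quantifier over \<open>Lower\<close> can be
    moved to representatives.\<close>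
  have "Lower (quotient_order H) (quotient_map H ` T) \<subseteq> range (quotient_map H)"
    by (auto simp: Lower_def carrier_quotient_order)
  then have "Lower (quotient_order H) (quotient_map H ` T) =
      quotient_map H ` {b. quotient_map H b \<in> Lower (quotient_order H) (quotient_map H ` T)}"
    by auto
  then have "Lower (quotient_order H) (quotient_map H ` T) =
      quotient_map H ` {b. \<forall>t\<in>T. b \<le> t \<or> b - t \<in> H}"
    by (simp only: lower)
  then have "(\<forall>X\<in>Lower (quotient_order H) (quotient_map H ` T).
        le (quotient_order H) X (quotient_map H g)) \<longleftrightarrow>
      (\<forall>b. (\<forall>t\<in>T. b \<le> t \<or> b - t \<in> H) \<longrightarrow> b \<le> g \<or> b - g \<in> H)"
    by (simp add: le_quotient_iff)
  then show ?thesis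
    using \<open>_ \<subseteq> range (quotient_map H)\<close> lower[of g]
    unfolding greatest_def carrier_quotient_order by argo
qed

text \<open>\<open>a\<close> itself may lie outside \<open>S\<close>; only its coset is known to
  meet \<open>S\<close>, hence the extra point \<open>m\<close>.\<close>

lemma quotient_eq_segment_fromD:
  assumes "quotient_map H ` S = segment_from (quotient_order H) (quotient_map H a)"
  obtains m where "m \<in> S" "m - a \<in> H" "\<And>s. s \<in> S \<Longrightarrow> a \<le> s \<or> a - s \<in> H"
proof -
  have "quotient_map H a \<in> quotient_map H ` S"
    by (simp add: assms segment_from_def carrier_quotient_order le_quotient_iff)
  then obtain m where "m \<in> S" "m - a \<in> H"
    by (metis imageE quotient_map_eq_iff)
  moreover have "a \<le> s \<or> a - s \<in> H" if "s \<in> S" for s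
  proof -
    have "quotient_map H s \<in> segment_from (quotient_order H) (quotient_map H a)"
      using that assms by blast
    then show ?thesis
      by (simp add: segment_from_def le_quotient_iff)
  qed
  ultimately show ?thesis
    using that by blast
qed

text \<open>Of an element and its negative one is nonnegative, and a subgroup contains both or
  neither.\<close>

lemma nonneg_outside:
  assumes "convex_subgroup K" "\<not> K \<subseteq> H"
  obtains a where "0 \<le> a" "a \<in> K" "a \<notin> H"
proof -
  obtain a where a: "a \<in> K" "a \<notin> H"
    using assms by blast
  then have "- a \<in> K" "- a \<notin> H"
    using convex_subgroup.uminus_mem[OF assms(1)] uminus_mem[of "- a"] by auto
  then show ?thesis
    using a that linear[of 0 a] by (metis neg_0_le_iff_le)
qed

text \<open>Take nonnegative witnesses against both inclusions: by convexity the smaller one would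
  lie in both subgroups.\<close>

lemma convex_subgroup_linear:
  assumes K: "convex_subgroup K"
  shows "K \<subseteq> H \<or> H \<subseteq> K"
proof (rule ccontr)
  assume "\<not> ?thesis"
  then have "\<not> K \<subseteq> H" "\<not> H \<subseteq> K"
    by auto
  obtain a where "0 \<le> a" "a \<in> K" "a \<notin> H"
    using nonneg_outside[OF K \<open>\<not> K \<subseteq> H\<close>] .
  moreover obtain b where "0 \<le> b" "b \<in> H" "b \<notin> K"
    using convex_subgroup.nonneg_outside[OF K convex_subgroup_axioms \<open>\<not> H \<subseteq> K\<close>] .
  ultimately show False
    using convex[of b a] convex_subgroup.convex[OF K, of a b] linear[of a b] by blast
qed

end

section \<open>Final segments of the group and their invariance groups\<close>

lemma final_segment_whole_iff:
  "final_segment whole S \<longleftrightarrow> S \<noteq> {} \<and> S \<noteq> UNIV \<and> (\<forall>x\<in>S. \<forall>y. x \<le> y \<longrightarrow> y \<in> S)"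
  by (simp add: final_segment_def whole_def)

lemma final_segment_up: "\<lbrakk>final_segment whole S; x \<in> S; x \<le> y\<rbrakk> \<Longrightarrow> y \<in> S"
  by (auto simp: final_segment_whole_iff)

lemma final_segment_less: "\<lbrakk>final_segment whole S; x \<notin> S; y \<in> S\<rbrakk> \<Longrightarrow> x < y"
  by (meson final_segment_up not_less)

lemma mem_invariance_group: "\<gamma> \<in> invariance_group M \<longleftrightarrow> (\<forall>x. x + \<gamma> \<in> M \<longleftrightarrow> x \<in> M)"
proof -
  have "x \<in> M + {\<gamma>} \<longleftrightarrow> x - \<gamma> \<in> M" for x
    by (force simp: set_plus_def)
  then have "\<gamma> \<in> invariance_group M \<longleftrightarrow> (\<forall>x. x - \<gamma> \<in> M \<longleftrightarrow> x \<in> M)"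
    by (auto simp: invariance_group_def)
  also have "\<dots> \<longleftrightarrow> (\<forall>x. x + \<gamma> \<in> M \<longleftrightarrow> x \<in> M)"
    by (metis add_diff_cancel diff_add_cancel)
  finally show ?thesis .
qed

text \<open>Adding \<open>\<delta>\<close> stays in \<open>S\<close> by upward closure; only
  subtracting it can lead out.\<close>

lemma invariance_group_pos:
  assumes "final_segment whole S" "0 \<le> \<delta>"
  shows "\<delta> \<in> invariance_group S \<longleftrightarrow> (\<forall>s\<in>S. s - \<delta> \<in> S)"
proof
  assume "\<delta> \<in> invariance_group S"
  then show "\<forall>s\<in>S. s - \<delta> \<in> S"
    by (metis diff_add_cancel mem_invariance_group)
next
  assume *: "\<forall>s\<in>S. s - \<delta> \<in> S"
  have "x + \<delta> \<in> S \<longleftrightarrow> x \<in> S" for x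
    using * final_segment_up[OF assms(1), of x "x + \<delta>"] assms(2) by force
  then show "\<delta> \<in> invariance_group S"
    by (simp add: mem_invariance_group)
qed

lemma convex_subgroup_invariance_group:
  assumes S: "final_segment whole S"
  shows "convex_subgroup (invariance_group S)"
proof
  show "0 \<in> invariance_group S"
    by (simp add: mem_invariance_group)
next
  fix a b
  assume "a \<in> invariance_group S" "b \<in> invariance_group S"
  then have "x + (a - b) \<in> S \<longleftrightarrow> x \<in> S" for x
    unfolding mem_invariance_group by (metis add_diff_eq diff_add_cancel)
  then show "a - b \<in> invariance_group S"
    by (simp add: mem_invariance_group)
next
  fix a b
  assume a: "a \<in> invariance_group S" and b: "0 \<le> b" "b \<le> a"
  then have "\<forall>s\<in>S. s - a \<in> S"
    using invariance_group_pos[OF S, of a] by auto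
  then have "\<forall>s\<in>S. s - b \<in> S"
    using final_segment_up[OF S] b by (meson diff_left_mono)
  then show "b \<in> invariance_group S"
    using invariance_group_pos[OF S] b by blast
qed

lemma not_invariantE:
  assumes "final_segment whole S" "0 \<le> \<delta>" "\<delta> \<notin> invariance_group S"
  obtains s where "s \<in> S" "s - \<delta> \<notin> S"
  using assms invariance_group_pos by blast

lemma mem_elementwise_diff: "x \<in> M \<ominus> N \<longleftrightarrow> (\<exists>n\<in>N. x + n \<in> M)"
proof
  assume "x \<in> M \<ominus> N"
  then obtain m n where "m \<in> M" "n \<in> N" "x = m - n"
    by (auto simp: elementwise_diff_def)
  then show "\<exists>n\<in>N. x + n \<in> M"
    by (metis diff_add_cancel)
next
  assume "\<exists>n\<in>N. x + n \<in> M"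
  then obtain n where "n \<in> N" "x + n \<in> M"
    by blast
  moreover have "x = (x + n) - n"
    by simp
  ultimately show "x \<in> M \<ominus> N"
    unfolding elementwise_diff_def by blast
qed

lemma mem_fs_diff: "\<alpha> \<in> fs_diff S2 S1 \<longleftrightarrow> (\<forall>s\<in>S1. \<alpha> + s \<in> S2)"
  by (auto simp: fs_diff_def elt_set_plus_def)

text \<open>Some step \<open>h \<in> H\<close> leads from \<open>s \<in> S\<close> out of \<open>S\<close>; then \<open>s/H\<close> is least in \<open>S/H\<close>.\<close>

lemma principal_quotient_of_psubset:
  assumes S: "final_segment whole S" and "convex_subgroup H" and "invariance_group S \<subset> H"
  shows "principal_in (quotient_order H) (quotient_map H ` S)"
proof -
  interpret H: convex_subgroup H
    by (fact assms)
  interpret K: convex_subgroup "invariance_group S"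
    by (rule convex_subgroup_invariance_group[OF S])
  have "\<not> H \<subseteq> invariance_group S"
    using assms(3) by blast
  then obtain h where h: "0 \<le> h" "h \<in> H" "h \<notin> invariance_group S"
    by (rule K.nonneg_outside[OF assms(2)])
  obtain s where s: "s \<in> S" "s - h \<notin> S"
    using not_invariantE[OF S h(1,3)] .
  have "s \<le> x \<or> s - x \<in> H" if "x \<in> S" for x
  proof (cases "s \<le> x")
    case False
    have "s - h < x"
      using final_segment_less[OF S] s that by blast
    then have "s - x \<le> h"
      by (simp add: algebra_simps less_imp_le)
    then show ?thesis
      using H.convex[OF h(2), of "s - x"] False by simp
  qed simp
  then show ?thesis
    using s unfolding H.principal_quotient_iff by blast
qed

section \<open>Constraints on any solution\<close>

text \<open>A translation that fixes one summand can be absorbed by it and so fixes the sum.\<close>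

lemma invariance_group_solution:
  assumes "S1 + T = S2"
  shows "invariance_group S1 \<subseteq> invariance_group S2" "invariance_group T \<subseteq> invariance_group S2"
proof -
  have *: "invariance_group A \<subseteq> invariance_group (A + B)" for A B :: "'a set"
  proof
    fix g
    assume g: "g \<in> invariance_group A"
    have "A + B + {g} = (A + {g}) + B"
      by (simp add: ac_simps)
    also have "\<dots> = A + B"
      using g by (simp add: invariance_group_def)
    finally show "g \<in> invariance_group (A + B)"
      by (simp add: invariance_group_def)
  qed
  show "invariance_group S1 \<subseteq> invariance_group S2"
    using *[of S1 T] assms by simp
  show "invariance_group T \<subseteq> invariance_group S2"
    using *[of T S1] assms by (simp add: add.commute)
qed

lemma solution_subset_fs_diff: "is_solution S1 S2 T \<Longrightarrow> T \<subseteq> fs_diff S2 S1"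
  unfolding is_solution_def mem_fs_diff subset_iff by (metis add.commute set_plus_intro)

lemma sum_fs_diff_subset: "S1 + fs_diff S2 S1 \<subseteq> S2"
  by (metis add.commute mem_fs_diff set_plus_elim subsetI)

text \<open>Split a representative of the least class as \<open>a = s + t\<close>. For
  \<open>x\<close> in \<open>S1\<close>, cancelling \<open>t\<close> from the comparison of
  \<open>a\<close> with \<open>x + t\<close> compares \<open>s\<close> with
  \<open>x\<close>.\<close>

lemma principal_quotient_summand:
  assumes S2: "final_segment whole S2" and eq: "S1 + T = S2"
    and p: "principal_in (quotient_order (invariance_group S2))
              (quotient_map (invariance_group S2) ` S2)"
  shows "principal_in (quotient_order (invariance_group S2))
           (quotient_map (invariance_group S2) ` S1)"
proof -
  interpret convex_subgroup "invariance_group S2"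
    by (rule convex_subgroup_invariance_group[OF S2])
  obtain a where a: "a \<in> S2" "\<And>s. s \<in> S2 \<Longrightarrow> a \<le> s \<or> a - s \<in> invariance_group S2"
    using p unfolding principal_quotient_iff by blast
  obtain s t where st: "s \<in> S1" "t \<in> T" "a = s + t"
    using a(1) unfolding eq[symmetric] by (rule set_plus_elim)
  have "s \<le> x \<or> s - x \<in> invariance_group S2" if "x \<in> S1" for x
  proof -
    have "x + t \<in> S2"
      using set_plus_intro[OF that st(2)] eq by simp
    from a(2)[OF this] show ?thesis
      using st by simp
  qed
  then show ?thesis
    using st unfolding principal_quotient_iff by blast
qed

section \<open>The largest candidate, and the principal case\<close>

text \<open>Take a point inside and one outside each segment: \<open>s2 - c1\<close> belongs to the
  difference since all of \<open>S1\<close> lies above \<open>c1\<close>, whereas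
  \<open>c2 - s1\<close> carries \<open>s1\<close> to \<open>c2\<close>, outside
  \<open>S2\<close>.\<close>

lemma final_segment_fs_diff:
  assumes S1: "final_segment whole S1" and S2: "final_segment whole S2"
  shows "final_segment whole (fs_diff S2 S1)"
proof -
  obtain c1 s1 c2 s2 where *: "c1 \<notin> S1" "s1 \<in> S1" "c2 \<notin> S2" "s2 \<in> S2"
    using assms by (auto simp: final_segment_whole_iff)
  have "s2 - c1 + s \<in> S2" if "s \<in> S1" for s
  proof -
    have "c1 < s"
      using final_segment_less[OF S1] * that by blast
    then have "s2 \<le> s2 - c1 + s"
      by (simp add: algebra_simps)
    then show ?thesis
      using final_segment_up[OF S2] * by blast
  qed
  then have "s2 - c1 \<in> fs_diff S2 S1"
    by (simp add: mem_fs_diff)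
  moreover have "c2 - s1 \<notin> fs_diff S2 S1"
    using * by (force simp: mem_fs_diff)
  moreover have "y \<in> fs_diff S2 S1" if "x \<in> fs_diff S2 S1" "x \<le> y" for x y
    using that final_segment_up[OF S2] unfolding mem_fs_diff by (meson add_right_mono)
  ultimately show ?thesis
    unfolding final_segment_whole_iff by blast
qed

text \<open>Membership of \<open>x + u\<close> in \<open>S2\<close> depends only on the class of
  \<open>u\<close>. So \<open>x + S1\<close> lies in \<open>S2\<close> as soon as the least class
  does; conversely \<open>m\<close> represents that class within \<open>S1\<close>.\<close>

lemma fs_diff_principal:
  assumes S2: "final_segment whole S2"
    and m: "m \<in> S1" "m - a \<in> invariance_group S2"
    and a: "\<And>s. s \<in> S1 \<Longrightarrow> a \<le> s \<or> a - s \<in> invariance_group S2"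
  shows "fs_diff S2 S1 = S2 \<ominus> {a}"
proof (rule Set.set_eqI)
  fix x
  interpret convex_subgroup "invariance_group S2"
    by (rule convex_subgroup_invariance_group[OF S2])
  have inv: "x + u \<in> S2 \<longleftrightarrow> x + v \<in> S2" if "u - v \<in> invariance_group S2" for u v
  proof -
    have "(x + v) + (u - v) \<in> S2 \<longleftrightarrow> x + v \<in> S2"
      using that unfolding mem_invariance_group by blast
    then show ?thesis
      by simp
  qed
  have "x + s \<in> S2" if "x + a \<in> S2" "s \<in> S1" for s
    using a[OF that(2)]
  proof
    assume "a \<le> s"
    then show ?thesis
      using final_segment_up[OF S2 that(1)] by simp
  next
    assume "a - s \<in> invariance_group S2"
    then show ?thesis
      using inv that by blast
  qed
  then show "x \<in> fs_diff S2 S1 \<longleftrightarrow> x \<in> S2 \<ominus> {a}"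
    using inv m by (auto simp: mem_fs_diff mem_elementwise_diff)
qed

lemma is_solution_fs_diff_principal:
  assumes S1: "final_segment whole S1" and S2: "final_segment whole S2"
    and p: "principal_in (quotient_order (invariance_group S2))
              (quotient_map (invariance_group S2) ` S1)"
  shows "is_solution S1 S2 (fs_diff S2 S1)"
proof -
  interpret convex_subgroup "invariance_group S2"
    by (rule convex_subgroup_invariance_group[OF S2])
  obtain a where a: "a \<in> S1" "\<And>s. s \<in> S1 \<Longrightarrow> a \<le> s \<or> a - s \<in> invariance_group S2"
    using p unfolding principal_quotient_iff by blast
  have D: "fs_diff S2 S1 = S2 \<ominus> {a}"
    by (rule fs_diff_principal[OF S2 a(1)]) (use a(2) zero_mem in simp_all)
  have "s \<in> S1 + fs_diff S2 S1" if "s \<in> S2" for s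
  proof -
    have "s - a \<in> fs_diff S2 S1"
      using that by (simp add: D mem_elementwise_diff)
    from set_plus_intro[OF a(1) this] show ?thesis
      by simp
  qed
  then show ?thesis
    using final_segment_fs_diff[OF S1 S2] sum_fs_diff_subset unfolding is_solution_def by blast
qed

section \<open>The nonprincipal case\<close>

text \<open>\<open>inv_eq\<close> is the only way for the inclusion in
  \<open>solvability_condition\<close> to hold here: by
  \<open>principal_quotient_of_psubset\<close>, a strict inclusion would contradict
  \<open>np1\<close>.\<close>

locale nonprincipal_equation =
  fixes S1 S2 :: "'a::linordered_ab_group_add set"
  assumes S1: "final_segment whole S1" and S2: "final_segment whole S2"
    and inv_eq: "invariance_group S1 = invariance_group S2"
    and np1: "\<not> principal_in (quotient_order (invariance_group S2))
                (quotient_map (invariance_group S2) ` S1)"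
    and np2: "\<not> principal_in (quotient_order (invariance_group S2))
                (quotient_map (invariance_group S2) ` S2)"
begin

sublocale convex_subgroup "invariance_group S2"
  by (rule convex_subgroup_invariance_group[OF S2])

lemma lower1:
  assumes "s \<in> S1"
  obtains s' where "s' \<in> S1" "s' < s" "s - s' \<notin> invariance_group S2"
  using np1 assms unfolding principal_quotient_iff by (meson not_le)

lemma lower2:
  assumes "s \<in> S2"
  obtains s' where "s' \<in> S2" "s' < s" "s - s' \<notin> invariance_group S2"
  using np2 assms unfolding principal_quotient_iff by (meson not_le)

text \<open>Here \<open>inv_eq\<close> enters: steps found while working in \<open>S2\<close> become
  steps that leave \<open>S1\<close>.\<close>

lemma cross1:
  assumes "0 \<le> \<delta>" "\<delta> \<notin> invariance_group S2"
  obtains s where "s \<in> S1" "s - \<delta> \<notin> S1"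
  using not_invariantE[OF S1] assms inv_eq by metis

lemma diff_compl_subset: "S2 \<ominus> (- S1) \<subseteq> fs_diff S2 S1"
proof
  fix x
  assume "x \<in> S2 \<ominus> (- S1)"
  then obtain c where c: "c \<notin> S1" "x + c \<in> S2"
    by (auto simp: mem_elementwise_diff)
  have "x + s \<in> S2" if "s \<in> S1" for s
    using final_segment_up[OF S2 c(2), of "x + s"] final_segment_less[OF S1 c(1) that] by simp
  then show "x \<in> fs_diff S2 S1"
    by (simp add: mem_fs_diff)
qed

lemma sum_diff_compl: "S2 \<subseteq> S1 + (S2 \<ominus> (- S1))"
proof
  fix s
  assume "s \<in> S2"
  then obtain s' where s': "s' \<in> S2" "s' < s" "s - s' \<notin> invariance_group S2"
    by (rule lower2)
  then obtain r where r: "r \<in> S1" "r - (s - s') \<notin> S1"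
    using cross1[of "s - s'"] by (metis diff_ge_0_iff_ge less_imp_le)
  \<comment> \<open>The point \<open>r - (s - s')\<close> outside \<open>S1\<close> is carried by
    \<open>s - r\<close> to \<open>s'\<close> in \<open>S2\<close>.\<close>
  have "(s - r) + (r - (s - s')) = s'"
    by simp
  then have "s - r \<in> S2 \<ominus> (- S1)"
    using r s' unfolding mem_elementwise_diff by (metis ComplI)
  from set_plus_intro[OF r(1) this] show "s \<in> S1 + (S2 \<ominus> (- S1))"
    by simp
qed

lemma sum_diff_compl_eq: "S1 + (S2 \<ominus> (- S1)) = S2"
  using sum_diff_compl sum_fs_diff_subset set_plus_mono2[OF order_refl diff_compl_subset, of S1]
  by blast

lemma is_solution_fs_diff: "is_solution S1 S2 (fs_diff S2 S1)"
proof -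
  have "S2 \<subseteq> S1 + fs_diff S2 S1"
    using sum_diff_compl set_plus_mono2[OF order_refl diff_compl_subset, of S1] by blast
  then show ?thesis
    using sum_fs_diff_subset final_segment_fs_diff[OF S1 S2] by (auto simp: is_solution_def)
qed

lemma diff_compl_up: "\<lbrakk>x \<in> S2 \<ominus> (- S1); x \<le> y\<rbrakk> \<Longrightarrow> y \<in> S2 \<ominus> (- S1)"
  unfolding mem_elementwise_diff by (meson add_right_mono final_segment_up[OF S2])

text \<open>One inclusion holds because this set solves the equation, the other because it is a
  union of translates of \<open>S2\<close>. So \<open>diamond\<close> works modulo
  \<open>invariance_group S2\<close>.\<close>

lemma invariance_group_diff_compl:
  "invariance_group (S2 \<ominus> (- S1)) = invariance_group S2"
proof
  show "invariance_group (S2 \<ominus> (- S1)) \<subseteq> invariance_group S2"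
    by (rule invariance_group_solution(2)[OF sum_diff_compl_eq])
  show "invariance_group S2 \<subseteq> invariance_group (S2 \<ominus> (- S1))"
  proof
    fix g
    assume "g \<in> invariance_group S2"
    then have "(x + c) + g \<in> S2 \<longleftrightarrow> x + c \<in> S2" for x c
      unfolding mem_invariance_group by blast
    then show "g \<in> invariance_group (S2 \<ominus> (- S1))"
      by (simp add: mem_invariance_group mem_elementwise_diff ac_simps)
  qed
qed

lemma diff_compl_coset:
  assumes "t \<in> S2 \<ominus> (- S1)" "t - x \<in> invariance_group S2"
  shows "x \<in> S2 \<ominus> (- S1)"
proof -
  have "t - x \<in> invariance_group (S2 \<ominus> (- S1))"
    using assms by (simp add: invariance_group_diff_compl)
  then have "x + (t - x) \<in> S2 \<ominus> (- S1) \<longleftrightarrow> x \<in> S2 \<ominus> (- S1)"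
    unfolding mem_invariance_group by blast
  then show ?thesis
    using assms by simp
qed

lemma mem_diff_compl_if_not_lower:
  assumes "\<not> (\<forall>t\<in>S2 \<ominus> (- S1). b \<le> t \<or> b - t \<in> invariance_group S2)"
  shows "b \<in> S2 \<ominus> (- S1)"
  using assms diff_compl_up by (meson not_le less_imp_le)

text \<open>There is no least class: if \<open>b + c\<close> is in \<open>S2\<close> with
  \<open>c\<close> outside \<open>S1\<close>, lower \<open>b + c\<close> to some \<open>s'\<close>
  in \<open>S2\<close> by a step outside the subgroup; then \<open>s' - c\<close> has a strictly
  smaller class than \<open>b\<close>.\<close>

lemma diff_compl_not_lower:
  assumes "b \<in> S2 \<ominus> (- S1)"
  shows "\<not> (\<forall>t\<in>S2 \<ominus> (- S1). b \<le> t \<or> b - t \<in> invariance_group S2)"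
proof -
  obtain c where c: "c \<notin> S1" "b + c \<in> S2"
    using assms by (auto simp: mem_elementwise_diff)
  obtain s' where s': "s' \<in> S2" "s' < b + c" "b + c - s' \<notin> invariance_group S2"
    using lower2[OF c(2)] .
  have "s' - c \<in> S2 \<ominus> (- S1)"
    using s' c unfolding mem_elementwise_diff by (metis ComplI diff_add_cancel)
  moreover have "s' - c < b"
    using s' by (simp add: less_diff_eq diff_less_eq)
  moreover have "b - (s' - c) \<notin> invariance_group S2"
    using s' by (simp add: algebra_simps)
  ultimately show ?thesis
    by (meson not_le)
qed

text \<open>Upward closure gives one direction, the absence of a least class the other. An infimum
  class is thus a greatest class of the complement.\<close>

lemma lower_iff:
  "(\<forall>t\<in>S2 \<ominus> (- S1). b \<le> t \<or> b - t \<in> invariance_group S2) \<longleftrightarrow> b \<notin> S2 \<ominus> (- S1)"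
  using mem_diff_compl_if_not_lower diff_compl_not_lower by blast

lemma fs_diff_eq_diamond: "fs_diff S2 S1 = diamond (S2 \<ominus> (- S1))"
proof -
  let ?T = "S2 \<ominus> (- S1)" and ?H = "invariance_group S2"
  \<comment> \<open>For \<open>g\<close> outside \<open>?T\<close> this says, by
    \<open>lower_iff\<close>, that \<open>g\<close> represents the infimum of \<open>?T\<close>
    modulo \<open>?H\<close>.\<close>
  let ?inf = "\<lambda>g. \<forall>b. b \<notin> ?T \<longrightarrow> b \<le> g \<or> b - g \<in> ?H"
  have mem_diamond: "x \<in> diamond ?T \<longleftrightarrow> x \<in> ?T \<or> ?inf x" for x
  proof -
    have "quotient_map ?H x \<in> quotient_map ?H ` ?T \<longleftrightarrow> x \<in> ?T"
      using diff_compl_coset quotient_map_eq_iff by (metis (no_types, lifting) diff_mem_commute imageE imageI)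
    then have "x \<in> diamond ?T \<longleftrightarrow> x \<in> ?T \<or> (x \<notin> ?T \<and> ?inf x)"
      by (simp add: diamond_def Let_def invariance_group_diff_compl add_infimum_def
          infimum_quotient_iff lower_iff)
    then show ?thesis
      by blast
  qed
  have "x \<in> fs_diff S2 S1" if "?inf x" for x
    unfolding mem_fs_diff
  proof
    fix s
    assume "s \<in> S1"
    then obtain s' where s': "s' \<in> S1" "s' < s" "s - s' \<notin> ?H"
      by (rule lower1)
    have "x < x + (s - s')" "x + (s - s') - x \<notin> ?H"
      using s' by simp_all
    \<comment> \<open>A step outside \<open>?H\<close> takes \<open>x\<close> beyond every class of
      the complement of \<open>?T\<close>; the step is compensated by passing from \<open>s\<close>
      to \<open>s'\<close>.\<close>
    then have "x + (s - s') \<in> ?T"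
      using that by (meson not_le)
    then have "s' + (x + (s - s')) \<in> S2"
      using set_plus_intro[OF s'(1)] sum_diff_compl_eq by blast
    then show "x + s \<in> S2"
      by (simp add: algebra_simps)
  qed
  moreover have "?inf x" if x: "x \<in> fs_diff S2 S1" "x \<notin> ?T" for x
  proof (intro allI impI)
    fix b
    assume b: "b \<notin> ?T"
    show "b \<le> x \<or> b - x \<in> ?H"
    proof (rule ccontr)
      assume "\<not> ?thesis"
      \<comment> \<open>The step \<open>b - x\<close> is positive and outside \<open>?H\<close>, so
        it crosses the boundary of \<open>S1\<close>; the point reached outside \<open>S1\<close>
        puts \<open>b\<close> into \<open>?T\<close>.\<close>
      then obtain s where s: "s \<in> S1" "s - (b - x) \<notin> S1"
        using cross1[of "b - x"] by (metis diff_ge_0_iff_ge linear)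
      have "b + (s - (b - x)) = x + s"
        by simp
      moreover have "x + s \<in> S2"
        using x s by (simp add: mem_fs_diff)
      ultimately have "b \<in> ?T"
        using s unfolding mem_elementwise_diff by (metis ComplI)
      then show False
        using b by blast
    qed
  qed
  ultimately show ?thesis
    using mem_diamond diff_compl_subset by blast
qed

end

theorem theorem2p33:
  fixes S1 S2 :: "'a::linordered_ab_group_add set"
  assumes "final_segment whole S1" and "final_segment whole S2"
  shows
    "(solvability_condition S1 S2 \<longrightarrow>
        is_solution S1 S2 (fs_diff S2 S1) \<and>
        (\<forall>T. is_solution S1 S2 T \<longrightarrow> T \<subseteq> fs_diff S2 S1) \<and>
        (\<forall>\<alpha>. quotient_map (invariance_group S2) ` S1 =
                segment_from (quotient_order (invariance_group S2))
                  (quotient_map (invariance_group S2) \<alpha>) \<longrightarrow>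
              fs_diff S2 S1 = S2 \<ominus> {\<alpha>}) \<and>
        (\<not> principal_in (quotient_order (invariance_group S2))
              (quotient_map (invariance_group S2) ` S1) \<longrightarrow>
           fs_diff S2 S1 = diamond (S2 \<ominus> (- S1)))) \<and>
     (\<not> solvability_condition S1 S2 \<longleftrightarrow>
        invariance_group S2 \<subset> invariance_group S1 \<or>
        (invariance_group S1 = invariance_group S2 \<and>
         \<not> principal_in (quotient_order (invariance_group S2))
              (quotient_map (invariance_group S2) ` S1) \<and>
         principal_in (quotient_order (invariance_group S2))
              (quotient_map (invariance_group S2) ` S2))) \<and>
     (\<not> solvability_condition S1 S2 \<longrightarrow> \<not> (\<exists>T. is_solution S1 S2 T))"
proof -
  let ?H = "invariance_group S2"
  let ?P = "\<lambda>S. principal_in (quotient_order ?H) (quotient_map ?H ` S)"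
  note S1 = assms(1) and S2 = assms(2)
  interpret H: convex_subgroup ?H
    by (rule convex_subgroup_invariance_group[OF S2])
  have cond: "solvability_condition S1 S2 \<longleftrightarrow> invariance_group S1 \<subseteq> ?H \<and> (\<not> ?P S1 \<longrightarrow> \<not> ?P S2)"
    by (simp add: solvability_condition_def Let_def)
  have psub: "?P S1" if "invariance_group S1 \<subset> ?H"
    using principal_quotient_of_psubset[OF S1 H.convex_subgroup_axioms that] .
  have nonprincipal: "nonprincipal_equation S1 S2" if "solvability_condition S1 S2" "\<not> ?P S1"
    using that psub S1 S2 cond by unfold_locales auto
  have "is_solution S1 S2 (fs_diff S2 S1)" if "solvability_condition S1 S2"
    using is_solution_fs_diff_principal[OF S1 S2]
      nonprincipal_equation.is_solution_fs_diff[OF nonprincipal[OF that]] by blast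
  moreover have "fs_diff S2 S1 = S2 \<ominus> {\<alpha>}"
    if "quotient_map ?H ` S1 = segment_from (quotient_order ?H) (quotient_map ?H \<alpha>)" for \<alpha>
    using H.quotient_eq_segment_fromD[OF that] fs_diff_principal[OF S2] by metis
  moreover have "fs_diff S2 S1 = diamond (S2 \<ominus> (- S1))"
    if "solvability_condition S1 S2" "\<not> ?P S1"
    using nonprincipal_equation.fs_diff_eq_diamond[OF nonprincipal[OF that]] .
  \<comment> \<open>Comparability of convex subgroups turns a failed inclusion into the reverse
    strict one. If the inclusion holds, \<open>?P S1\<close> fails, and \<open>psub\<close> leaves
    only equality.\<close>
  moreover have "\<not> solvability_condition S1 S2 \<longleftrightarrow>
      ?H \<subset> invariance_group S1 \<or> (invariance_group S1 = ?H \<and> \<not> ?P S1 \<and> ?P S2)"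
    using H.convex_subgroup_linear[OF convex_subgroup_invariance_group[OF S1]] psub
    unfolding cond by blast
  \<comment> \<open>Insolvability is obtained by contraposition: a solution forces both halves of
    the condition.\<close>
  moreover have "solvability_condition S1 S2" if "is_solution S1 S2 T" for T
    using that invariance_group_solution(1) principal_quotient_summand[OF S2]
    unfolding cond is_solution_def by blast
  ultimately show ?thesis
    using solution_subset_fs_diff by blast
qed

end
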